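(* Let $\alpha=(\alpha_1,\ldots,\alpha_m)\in\mathbb{R}^m$ and let $n$ be a positive integer. For integers $j,k$ define $$d_{\alpha}(j,k)=\sqrt{\sum_{i=1}^m\|(k-j)\alpha_i\|^2},$$ where $\|x\|$ denotes the distance from $x$ to the nearest integer. For $1\le r\le m$ let $I^r_{j,k}$ denote the geodesic joining $\{j\alpha_r\}$ and $\{k\alpha_r\}$. Define $$S_{\alpha}(n)=\{d_{\alpha}(j,k): 1\le j<k\le n,\ \text{and for all } 1\le p<q\le n \text{ with } d_\alpha(p,q)<d_\alpha(j,k) \text{ we have } I^r_{p,q}\cap I^r_{j,k}=\emptyset \text{ for all } r\}.$$ Then $$|S_\alpha(n)|\le \lceil\sqrt m\,\rceil^m\left(\lceil\sqrt m\,\rceil^m+2^m+1\right)+2.$$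
   Context: $\{x\}$ denotes the fractional part of $x$. For two points $u,v\in[0,1)$, let $m_0=\min(u,v)$ and $M_0=\max(u,v)$; the geodesic joining $u$ and $v$ is $[m_0,M_0)$ if $M_0-m_0\le 1/2$, and $[0,m_0)\cup[M_0,1)$ otherwise. *)

theory Defs
  imports "HOL-Analysis.Analysis"
begin

definition int_dist :: "real \<Rightarrow> real" where
  "int_dist x = \<bar>x - of_int (round x)\<bar>"

definition kron_dist :: "real ^ 'm \<Rightarrow> int \<Rightarrow> int \<Rightarrow> real" where
  "kron_dist \<alpha> j k = sqrt (\<Sum>i\<in>UNIV. (int_dist (of_int (k - j) * \<alpha> $ i))\<^sup>2)"

text \<open>
  The geodesic joining two points of the circle, represented as points of \<open>[0, 1)\<close>;
  a separation of exactly one half selects the arc not containing 0 in its interior.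
  In particular the geodesic joining a point to itself is empty.
\<close>

definition geodesic :: "real \<Rightarrow> real \<Rightarrow> real set" where
  "geodesic u v =
     (if max u v - min u v \<le> 1 / 2 then {min u v ..< max u v}
      else {0 ..< min u v} \<union> {max u v ..< 1})"

definition kron_geodesic :: "real ^ 'm \<Rightarrow> 'm \<Rightarrow> int \<Rightarrow> int \<Rightarrow> real set" where
  "kron_geodesic \<alpha> r j k = geodesic (frac (of_int j * \<alpha> $ r)) (frac (of_int k * \<alpha> $ r))"

definition gap_lengths :: "real ^ 'm \<Rightarrow> nat \<Rightarrow> real set" where
  "gap_lengths \<alpha> n =
     {kron_dist \<alpha> j k | j k. 1 \<le> j \<and> j < k \<and> k \<le> int n \<and>
        (\<forall>p q. 1 \<le> p \<and> p < q \<and> q \<le> int n \<and> kron_dist \<alpha> p q < kron_dist \<alpha> j k \<longrightarrow>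
           (\<forall>r. kron_geodesic \<alpha> r p q \<inter> kron_geodesic \<alpha> r j k = {}))}"

end

theory Submission
  imports Defs
begin

text \<open>
  Realise each gap length by a pair \<open>j < k\<close> and record the displacement vector from \<open>j\<alpha>\<close> to \<open>k\<alpha>\<close>
  along the geodesics, a vector of \<open>[-1/2, 1/2]\<^sup>m\<close> whose norm is the gap length. Group the gap
  lengths by the sign pattern of this vector. In one group, let the longest length be realised
  by \<open>(q, y)\<close>. A shorter displacement with index difference \<open>h\<close> in the group cannot start at \<open>q\<close> or
  end at \<open>y\<close>, so \<open>q + h > n\<close> and \<open>h \<ge> y\<close>. Hence for two of them the difference \<open>g\<close> of their index
  differences is so small that \<open>q + g\<close> and \<open>y + g\<close> are both at most \<open>n\<close>; if the two displacements
  were closer than the longest length, then \<open>(q, q + g)\<close> and \<open>(y, y + g)\<close> would be short pairs, forced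
  by disjointness to point in opposite directions. So all but one of the displacements of a
  group are separated by more than their norms, and packing inside one orthant bounds their
  number: by \<open>\<lceil>sqrt m\<rceil>\<^sup>m\<close> in general, and by the size of the support if that is at most 3. Summing
  over all sign patterns gives at most the claimed number; for \<open>m = 4\<close> the sum is 529, against 530.
\<close>

subsection \<open>Displacements on the circle\<close>

lemma abs_diff_same_sgn:
  fixes x y :: real
  assumes "sgn x = sgn y"
  shows "\<bar>x - y\<bar> = \<bar>\<bar>x\<bar> - \<bar>y\<bar>\<bar>"
proof (cases "x = 0")
  case True
  with assms show ?thesis by (simp add: sgn_zero_iff)
next
  case False
  have "x - y = sgn x * (\<bar>x\<bar> - \<bar>y\<bar>)" using assms by (metis right_diff_distrib sgn_mult_abs)
  then have "\<bar>x - y\<bar> = \<bar>sgn x\<bar> * \<bar>\<bar>x\<bar> - \<bar>y\<bar>\<bar>" by (simp only: abs_mult)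
  with False show ?thesis by (simp only: abs_sgn_eq if_False mult_1)
qed

lemma mult_pos_same_sgn:
  fixes x y :: real
  assumes "sgn x = sgn y" "x \<noteq> 0"
  shows "0 < x * y"
  using assms by (metis mult_neg_neg mult_pos_pos linorder_neqE sgn_greater sgn_less)

text \<open>Two numbers in \<open>(0, 1/2]\<close> differ by less than 1/2 because the subtracted
  one is positive. The strictness lets differences of displacements within a sign class be reduced
  modulo 1 without ambiguity.\<close>

lemma abs_diff_same_sgn_less:
  fixes x y :: real
  assumes "sgn x = sgn y" "\<bar>x\<bar> \<le> 1 / 2" "\<bar>y\<bar> \<le> 1 / 2"
  shows "\<bar>x - y\<bar> < 1 / 2"
proof (cases "x = 0")
  case True
  with assms(1) show ?thesis by (simp add: sgn_zero_iff)
next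
  case False
  with assms(1) have "y \<noteq> 0" by (metis sgn_zero_iff)
  have less: "a - b < 1 / 2" if "a \<le> 1 / 2" "0 < b" for a b :: real using that by linarith
  have "\<bar>\<bar>x\<bar> - \<bar>y\<bar>\<bar> < 1 / 2"
    unfolding abs_less_iff minus_diff_eq
    using False \<open>y \<noteq> 0\<close> assms(2,3) by (simp only: less zero_less_abs_iff simp_thms)
  then show ?thesis by (simp only: abs_diff_same_sgn[OF assms(1)])
qed

text \<open>
  The signed length of the geodesic from \<open>u\<close> to \<open>v\<close>. Its sign for antipodal points is the
  direction of the arc that the geodesic selects, so it is not a function of \<open>v - u\<close> modulo 1.
\<close>

definition circ_disp :: "real \<Rightarrow> real \<Rightarrow> real" where
  "circ_disp u v =
     (if \<bar>v - u\<bar> \<le> 1 / 2 then v - u else if u < v then v - u - 1 else v - u + 1)"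

lemma abs_circ_disp_le:
  assumes "u \<in> {0..<1}" "v \<in> {0..<1}"
  shows "\<bar>circ_disp u v\<bar> \<le> 1 / 2"
proof (cases "\<bar>v - u\<bar> \<le> 1 / 2")
  case False
  show ?thesis
  proof (cases "u < v")
    case True
    with False have "1 / 2 < v - u" by simp
    with assms have "\<bar>v - u - 1\<bar> \<le> 1 / 2" by simp
    with True False show ?thesis by (simp only: circ_disp_def if_True if_False)
  next
    case le: False
    with False have "v - u < - 1 / 2" by simp
    with assms have "\<bar>v - u + 1\<bar> \<le> 1 / 2" by simp
    with le False show ?thesis by (simp only: circ_disp_def if_False)
  qed
qed (simp only: circ_disp_def if_True)

lemma circ_disp_swap: "circ_disp v u = - circ_disp u v"
  by (auto simp: circ_disp_def)

lemma circ_disp_diff_Ints: "circ_disp u v - (v - u) \<in> \<int>"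
  by (simp add: circ_disp_def)

lemma geodesic_swap: "geodesic v u = geodesic u v"
  by (simp add: geodesic_def max.commute min.commute)

lemma geodesic_eq:
  "geodesic u v = (if \<bar>v - u\<bar> \<le> 1 / 2 then {min u v..<max u v} else {0..<min u v} \<union> {max u v..<1})"
proof -
  have "max u v - min u v = \<bar>v - u\<bar>" by (cases u v rule: linorder_le_cases) simp_all
  then show ?thesis by (simp only: geodesic_def)
qed

text \<open>Geodesics are closed on the left and open on the right in the increasing direction, so
  an arc that leaves \<open>u\<close> in that direction contains \<open>u\<close>.\<close>

lemma geodesic_if_circ_disp_pos:
  assumes "0 < circ_disp u v" "u \<in> {0..<1}" "v \<in> {0..<1}"
  shows "u \<in> geodesic u v"
proof (cases "\<bar>v - u\<bar> \<le> 1 / 2")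
  case True
  then have "u < v" using assms(1) by (simp only: circ_disp_def if_True diff_gt_0_iff_gt)
  with True show ?thesis by (simp add: geodesic_eq)
next
  case False
  have "v - u - 1 < 0" using assms(2,3) by simp
  then have "\<not> u < v" using assms(1) False by (metis circ_disp_def less_asym)
  with False assms(2) show ?thesis by (simp add: geodesic_eq)
qed

lemma geodesic_if_circ_disp_neg:
  assumes "circ_disp u v < 0" "u \<in> {0..<1}" "v \<in> {0..<1}"
  shows "v < u \<and> geodesic u v = {v..<u} \<or> u < v \<and> geodesic u v = {0..<u} \<union> {v..<1}"
proof (cases "\<bar>v - u\<bar> \<le> 1 / 2")
  case True
  then have "v < u" using assms(1) by (simp only: circ_disp_def if_True diff_less_0_iff_less)
  with True show ?thesis by (simp add: geodesic_eq)
next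
  case False
  have "0 < v - u + 1" using assms(2,3) by simp
  then have "u < v" using assms(1) False by (metis circ_disp_def less_asym)
  with False show ?thesis by (simp add: geodesic_eq)
qed

text \<open>Both arcs leave \<open>u\<close> in the same direction. In the increasing direction both
  contain \<open>u\<close>; in the other direction \<open>u\<close> is the excluded end, and the far
  end of the shorter arc lies in both.\<close>

lemma geodesic_meets:
  assumes "u \<in> {0..<1}" "v \<in> {0..<1}" "w \<in> {0..<1}"
    and "circ_disp u v * circ_disp u w > 0"
  shows "geodesic u v \<inter> geodesic u w \<noteq> {}"
proof -
  consider "circ_disp u v > 0" "circ_disp u w > 0" | "circ_disp u v < 0" "circ_disp u w < 0"
    using assms(4) unfolding zero_less_mult_iff by blast
  then show ?thesis
  proof cases
    case 1
    with assms(1-3) geodesic_if_circ_disp_pos show ?thesis by blast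
  next
    case 2
    note v = geodesic_if_circ_disp_neg[OF 2(1) assms(1,2)]
    note w = geodesic_if_circ_disp_neg[OF 2(2) assms(1,3)]
    have in01: "0 \<le> v" "v < 1" "0 \<le> w" "w < 1" using assms(2,3) by simp_all
    have "v \<in> geodesic u v \<inter> geodesic u w \<or> w \<in> geodesic u v \<inter> geodesic u w"
    proof (cases v w rule: linorder_le_cases)
      case le
      with v w in01 show ?thesis
        by (metis Un_iff IntI atLeastLessThan_iff order.strict_trans1 order.asym order.refl)
    next
      case ge
      with v w in01 show ?thesis
        by (metis Un_iff IntI atLeastLessThan_iff order.strict_trans1 order.asym order.refl)
    qed
    then show ?thesis by blast
  qed
qed

text \<open>The difference is an integer of absolute value below 1. The strict bound on one side
  rules out the pair 1/2 and -1/2.\<close>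

lemma eq_if_diff_Ints:
  fixes x y :: real
  assumes "\<bar>x\<bar> < 1 / 2" "\<bar>y\<bar> \<le> 1 / 2" "x - y \<in> \<int>"
  shows "x = y"
proof -
  have "\<bar>x - y\<bar> \<le> \<bar>x\<bar> + \<bar>y\<bar>" by (rule abs_triangle_ineq4)
  also have "\<dots> < 1 / 2 + 1 / 2" using assms(1,2) by (rule add_less_le_mono)
  finally have "\<bar>x - y\<bar> < 1" by (simp only: field_sum_of_halves)
  with assms(3) have "x - y = 0" by (rule Ints_nonzero_abs_less1)
  then show ?thesis by (simp only: eq_iff_diff_eq_0[symmetric])
qed

text \<open>Both \<open>x\<close> and \<open>t - round t\<close> represent \<open>t\<close> modulo 1
  in \<open>[-1/2, 1/2]\<close>. Such representatives agree unless both have absolute value 1/2, so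
  the absolute values always agree.\<close>

lemma int_dist_eq_abs:
  assumes x: "\<bar>x\<bar> \<le> 1 / 2" "x - t \<in> \<int>"
  shows "int_dist t = \<bar>x\<bar>"
proof -
  define e where "e = t - of_int (round t)"
  have e: "\<bar>e\<bar> \<le> 1 / 2" unfolding e_def by (subst abs_minus_commute) (rule of_int_round_abs_le)
  have "x - e = x - t + of_int (round t)" by (simp add: e_def)
  then have Ints: "x - e \<in> \<int>" using x(2) by (simp only: Ints_add Ints_of_int)
  consider "\<bar>x\<bar> < 1 / 2" | "\<bar>e\<bar> < 1 / 2" | "\<bar>x\<bar> = 1 / 2" "\<bar>e\<bar> = 1 / 2"
    using x(1) e unfolding le_less by blast
  then have "\<bar>e\<bar> = \<bar>x\<bar>"
  proof cases
    case 1
    from eq_if_diff_Ints[OF this e Ints] show ?thesis by simp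
  next
    case 2
    have "e - x \<in> \<int>" using Ints by (metis Ints_minus minus_diff_eq)
    from eq_if_diff_Ints[OF 2 x(1) this] show ?thesis by simp
  next
    case 3
    then show ?thesis by simp
  qed
  then show ?thesis by (simp only: int_dist_def e_def)
qed

subsection \<open>Displacements of the Kronecker sequence\<close>

definition kron_disp :: "real ^ 'm \<Rightarrow> int \<Rightarrow> int \<Rightarrow> real ^ 'm" where
  "kron_disp \<alpha> j k = (\<chi> r. circ_disp (frac (of_int j * \<alpha> $ r)) (frac (of_int k * \<alpha> $ r)))"

lemma frac_unit: "frac (x :: real) \<in> {0..<1}"
  by (simp add: frac_lt_1)

lemma abs_kron_disp_le: "\<bar>kron_disp \<alpha> j k $ r\<bar> \<le> 1 / 2"
  using abs_circ_disp_le[OF frac_unit frac_unit] by (simp add: kron_disp_def)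

lemma kron_disp_swap: "kron_disp \<alpha> k j = - kron_disp \<alpha> j k"
  by (simp add: kron_disp_def vec_eq_iff circ_disp_swap[of "frac _" "frac (of_int j * _)"])

lemma kron_disp_diff_Ints: "kron_disp \<alpha> j k $ r - of_int (k - j) * \<alpha> $ r \<in> \<int>"
proof -
  let ?u = "of_int j * \<alpha> $ r" and ?v = "of_int k * \<alpha> $ r"
  have "kron_disp \<alpha> j k $ r - of_int (k - j) * \<alpha> $ r
      = (circ_disp (frac ?u) (frac ?v) - (frac ?v - frac ?u)) + of_int (\<lfloor>?u\<rfloor> - \<lfloor>?v\<rfloor>)"
    by (simp add: kron_disp_def frac_def algebra_simps)
  then show ?thesis by (metis Ints_add Ints_of_int circ_disp_diff_Ints)
qed

lemma kron_dist_eq_norm: "kron_dist \<alpha> j k = norm (kron_disp \<alpha> j k)"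
proof -
  have "int_dist (of_int (k - j) * \<alpha> $ r) = \<bar>kron_disp \<alpha> j k $ r\<bar>" for r
    by (rule int_dist_eq_abs[OF abs_kron_disp_le kron_disp_diff_Ints])
  then show ?thesis by (simp add: kron_dist_def norm_vec_def L2_set_def)
qed

text \<open>\<open>kron_dist\<close> depends only on the index difference. The norm is therefore
  invariant under translation, although an antipodal coordinate may change its sign.\<close>

lemma norm_kron_disp_cong:
  assumes "k - j = k' - j'"
  shows "norm (kron_disp \<alpha> j k) = norm (kron_disp \<alpha> j' k')"
  using assms by (simp add: kron_dist_def flip: kron_dist_eq_norm)

text \<open>A coordinate is determined modulo 1 by the index difference; the strict bound excludes
  the antipodal case, the only one in which a translation can flip the sign.\<close>

lemma kron_disp_cong:
  assumes "k - j = k' - j'" "\<bar>kron_disp \<alpha> j k $ r\<bar> < 1 / 2"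
  shows "kron_disp \<alpha> j' k' $ r = kron_disp \<alpha> j k $ r"
proof -
  have "kron_disp \<alpha> j k $ r - kron_disp \<alpha> j' k' $ r \<in> \<int>"
    using Ints_diff[OF kron_disp_diff_Ints[of \<alpha> j k r] kron_disp_diff_Ints[of \<alpha> j' k' r]] assms(1)
    by (simp del: of_int_diff)
  with assms(2) abs_kron_disp_le show ?thesis by (metis eq_if_diff_Ints)
qed

text \<open>Displacements are additive modulo 1, and the strict bound singles out the
  representative.\<close>

lemma kron_disp_diff:
  assumes "k2 - p2 - (k1 - p1) = k - j"
    and "\<bar>kron_disp \<alpha> p2 k2 $ r - kron_disp \<alpha> p1 k1 $ r\<bar> < 1 / 2"
  shows "kron_disp \<alpha> j k $ r = kron_disp \<alpha> p2 k2 $ r - kron_disp \<alpha> p1 k1 $ r"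
proof -
  let ?A = "of_int (k2 - p2) * \<alpha> $ r" and ?B = "of_int (k1 - p1) * \<alpha> $ r"
    and ?C = "of_int (k - j) * \<alpha> $ r"
  have C: "?C = ?A - ?B" by (simp add: left_diff_distrib flip: assms(1))
  have "(kron_disp \<alpha> p2 k2 $ r - ?A) - (kron_disp \<alpha> p1 k1 $ r - ?B) - (kron_disp \<alpha> j k $ r - ?C) \<in> \<int>"
    by (intro Ints_diff kron_disp_diff_Ints)
  then have "kron_disp \<alpha> p2 k2 $ r - kron_disp \<alpha> p1 k1 $ r - kron_disp \<alpha> j k $ r \<in> \<int>"
    unfolding C by (simp add: algebra_simps)
  with assms(2) abs_kron_disp_le show ?thesis by (metis eq_if_diff_Ints)
qed

lemma kron_geodesic_swap: "kron_geodesic \<alpha> r k j = kron_geodesic \<alpha> r j k"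
  by (simp add: kron_geodesic_def geodesic_swap[of "frac (of_int j * _)"])

lemma kron_geodesic_meets:
  assumes "kron_disp \<alpha> j k $ r * kron_disp \<alpha> j l $ r > 0"
  shows "kron_geodesic \<alpha> r j k \<inter> kron_geodesic \<alpha> r j l \<noteq> {}"
  using assms unfolding kron_disp_def kron_geodesic_def vec_lambda_beta
  by (rule geodesic_meets[OF frac_unit frac_unit frac_unit])

section \<open>Pairs realising gap lengths and their shorter neighbours\<close>

definition is_gap :: "real ^ 'm \<Rightarrow> nat \<Rightarrow> int \<Rightarrow> int \<Rightarrow> bool" where
  "is_gap \<alpha> n j k \<longleftrightarrow> 1 \<le> j \<and> j < k \<and> k \<le> int n \<and>
     (\<forall>p q. 1 \<le> p \<and> p < q \<and> q \<le> int n \<and> kron_dist \<alpha> p q < kron_dist \<alpha> j k \<longrightarrow>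
        (\<forall>r. kron_geodesic \<alpha> r p q \<inter> kron_geodesic \<alpha> r j k = {}))"

text \<open>By disjointness, a shorter pair that shares an endpoint with the gap pair cannot leave
  this endpoint along the geodesic of the gap in any coordinate. That geodesic leaves
  \<open>q\<close> and \<open>y\<close> in opposite directions, hence the opposite
  inequalities.\<close>

lemma is_gap_neighbour:
  assumes gap: "is_gap \<alpha> n q y" and l: "l \<in> {1..int n}"
  shows "l \<noteq> q \<Longrightarrow> norm (kron_disp \<alpha> q l) < norm (kron_disp \<alpha> q y)
           \<Longrightarrow> kron_disp \<alpha> q y $ r * kron_disp \<alpha> q l $ r \<le> 0"
    and "l \<noteq> y \<Longrightarrow> norm (kron_disp \<alpha> y l) < norm (kron_disp \<alpha> q y)
           \<Longrightarrow> 0 \<le> kron_disp \<alpha> q y $ r * kron_disp \<alpha> y l $ r"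
proof -
  have disjoint: "kron_geodesic \<alpha> r p k \<inter> kron_geodesic \<alpha> r q y = {}"
    if "1 \<le> p" "p < k" "k \<le> int n" "norm (kron_disp \<alpha> p k) < norm (kron_disp \<alpha> q y)" for p k
    using gap that unfolding is_gap_def kron_dist_eq_norm by blast
  \<comment> \<open>The index \<open>l\<close> may lie on either side of \<open>j\<close>; swapping
    the pair restores the order that \<open>is_gap\<close> asks for.\<close>
  have *: "kron_geodesic \<alpha> r j l \<inter> kron_geodesic \<alpha> r q y = {}"
    if "l \<noteq> j" "norm (kron_disp \<alpha> j l) < norm (kron_disp \<alpha> q y)" "j \<in> {1..int n}" for j
  proof (cases "j < l")
    case True
    then show ?thesis using that l by (intro disjoint) simp_all
  next
    case False
    then have "kron_geodesic \<alpha> r l j \<inter> kron_geodesic \<alpha> r q y = {}"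
      using that l by (intro disjoint) (simp_all add: kron_disp_swap[of \<alpha> j l])
    then show ?thesis by (simp only: kron_geodesic_swap[of \<alpha> r j l])
  qed
  have qy: "q \<in> {1..int n}" "y \<in> {1..int n}" using gap by (auto simp: is_gap_def)
  show "kron_disp \<alpha> q y $ r * kron_disp \<alpha> q l $ r \<le> 0"
    if "l \<noteq> q" "norm (kron_disp \<alpha> q l) < norm (kron_disp \<alpha> q y)"
    using *[OF that qy(1)] kron_geodesic_meets[of \<alpha> q y r l] by (force simp: not_le)
  show "0 \<le> kron_disp \<alpha> q y $ r * kron_disp \<alpha> y l $ r"
    if "l \<noteq> y" "norm (kron_disp \<alpha> y l) < norm (kron_disp \<alpha> q y)"
  proof (rule ccontr)
    assume "\<not> ?thesis"
    then have "kron_disp \<alpha> y q $ r * kron_disp \<alpha> y l $ r > 0"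
      by (simp add: kron_disp_swap[of \<alpha> y q] not_le)
    from kron_geodesic_meets[OF this] *[OF that qy(2)] show False
      by (simp add: kron_geodesic_swap[of \<alpha> r y q] Int_commute)
  qed
qed

text \<open>
  If all nonzero coordinates of the shorter displacement had length exactly one half, it could
  not be shorter; and an arc shorter than one half has the same direction for all pairs with
  the same difference.
\<close>

lemma is_gap_same_signs_bounds:
  assumes gap: "is_gap \<alpha> n q y" and pk: "1 \<le> p" "p < k" "k \<le> int n"
    and sgn: "\<And>r. sgn (kron_disp \<alpha> p k $ r) = sgn (kron_disp \<alpha> q y $ r)"
    and less: "norm (kron_disp \<alpha> p k) < norm (kron_disp \<alpha> q y)"
  shows "int n < q + (k - p)" and "y \<le> k - p"
proof -
  obtain r where r: "kron_disp \<alpha> q y $ r \<noteq> 0" "\<bar>kron_disp \<alpha> p k $ r\<bar> < 1 / 2"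
  proof (rule ccontr)
    assume "\<not> thesis"
    then have *: "kron_disp \<alpha> q y $ r = 0 \<or> \<bar>kron_disp \<alpha> p k $ r\<bar> \<ge> 1 / 2" for r
      using that by (metis not_le)
    have "norm (kron_disp \<alpha> q y $ r) \<le> norm (kron_disp \<alpha> p k $ r)" for r
      using *[of r] abs_kron_disp_le[of \<alpha> q y r] by auto
    then have "norm (kron_disp \<alpha> q y) \<le> norm (kron_disp \<alpha> p k)"
      by (rule norm_le_componentwise_cart)
    with less show False by simp
  qed
  have pos: "kron_disp \<alpha> q y $ r * kron_disp \<alpha> p k $ r > 0"
    by (rule mult_pos_same_sgn) (simp_all only: sgn r(1) not_False_eq_True)
  have qy: "1 \<le> q" "q < y" "y \<le> int n" using gap by (auto simp: is_gap_def)
  \<comment> \<open>Otherwise the pair \<open>(p, k)\<close> can be translated to start at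
    \<open>q\<close>, where in coordinate \<open>r\<close> it follows the geodesic of the
    gap.\<close>
  show "int n < q + (k - p)"
  proof (rule ccontr)
    assume "\<not> ?thesis"
    with pk qy have l: "q + (k - p) \<in> {1..int n}" "q + (k - p) \<noteq> q" by auto
    have "norm (kron_disp \<alpha> q (q + (k - p))) < norm (kron_disp \<alpha> q y)"
      using norm_kron_disp_cong[of "q + (k - p)" q k p \<alpha>] less by simp
    from is_gap_neighbour(1)[OF gap l this, of r] pos r(2) show False
      using kron_disp_cong[of k p "q + (k - p)" q \<alpha> r] by simp
  qed
  \<comment> \<open>Otherwise it can be translated to end at \<open>y\<close>, and read backwards it
    leaves \<open>y\<close> along the geodesic of the gap.\<close>
  show "y \<le> k - p"
  proof (rule ccontr)
    assume "\<not> ?thesis"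
    with pk qy have l: "y - (k - p) \<in> {1..int n}" "y - (k - p) \<noteq> y" by auto
    have "norm (kron_disp \<alpha> y (y - (k - p))) < norm (kron_disp \<alpha> q y)"
      using norm_kron_disp_cong[of y "y - (k - p)" k p \<alpha>] less
      by (simp add: kron_disp_swap[of \<alpha> y])
    from is_gap_neighbour(2)[OF gap l this, of r] pos r(2) show False
      using kron_disp_cong[of k p y "y - (k - p)" \<alpha> r]
      by (simp add: kron_disp_swap[of \<alpha> y])
  qed
qed

lemma is_gap_same_signs_eq:
  assumes gap: "is_gap \<alpha> n q y"
    and pk1: "1 \<le> p1" "p1 < k1" "k1 \<le> int n" and pk2: "1 \<le> p2" "p2 < k2" "k2 \<le> int n"
    and sgn1: "\<And>r. sgn (kron_disp \<alpha> p1 k1 $ r) = sgn (kron_disp \<alpha> q y $ r)"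
    and sgn2: "\<And>r. sgn (kron_disp \<alpha> p2 k2 $ r) = sgn (kron_disp \<alpha> q y $ r)"
    and less1: "norm (kron_disp \<alpha> p1 k1) < norm (kron_disp \<alpha> q y)"
    and less2: "norm (kron_disp \<alpha> p2 k2) < norm (kron_disp \<alpha> q y)"
    and close: "norm (kron_disp \<alpha> p2 k2 - kron_disp \<alpha> p1 k1) < norm (kron_disp \<alpha> q y)"
    and lt: "k1 - p1 < k2 - p2"
  shows "kron_disp \<alpha> p1 k1 = kron_disp \<alpha> p2 k2"
proof -
  define g where "g = k2 - p2 - (k1 - p1)"
  have qy: "1 \<le> q" "q < y" "y \<le> int n" using gap by (auto simp: is_gap_def)
  have y: "y \<le> k1 - p1" using is_gap_same_signs_bounds[OF gap pk1 sgn1 less1] by simp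
  let ?d = "kron_disp \<alpha> p2 k2 - kron_disp \<alpha> p1 k1"
  have small: "\<bar>kron_disp \<alpha> p2 k2 $ r - kron_disp \<alpha> p1 k1 $ r\<bar> < 1 / 2" for r
    by (rule abs_diff_same_sgn_less) (simp_all only: sgn1 sgn2 abs_kron_disp_le)
  \<comment> \<open>No coordinate of \<open>?d\<close> reaches 1/2, so every pair with index
    difference \<open>g\<close> has exactly this displacement, whatever its starting index.\<close>
  have disp: "kron_disp \<alpha> j (j + g) = ?d" for j
    using kron_disp_diff[OF _ small] by (simp add: vec_eq_iff g_def)
  \<comment> \<open>Since \<open>y \<le> k1 - p1\<close> and \<open>k2 - p2 < n\<close>, even
    \<open>y + g < n\<close>; and \<open>q < y\<close>.\<close>
  have ranges: "q + g \<in> {1..int n}" "q + g \<noteq> q" "y + g \<in> {1..int n}" "y + g \<noteq> y"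
    unfolding g_def atLeastAtMost_iff using qy y pk1 pk2 lt by linarith+
  \<comment> \<open>The same vector \<open>?d\<close> leaves both ends of the gap, so the two
    opposite inequalities apply to one product.\<close>
  have "kron_disp \<alpha> q y $ r * ?d $ r = 0" for r
    using is_gap_neighbour(1)[OF gap ranges(1,2), of r] is_gap_neighbour(2)[OF gap ranges(3,4), of r]
    unfolding disp using close by (simp only: antisym)
  then have "kron_disp \<alpha> q y $ r = 0 \<or> kron_disp \<alpha> p2 k2 $ r = kron_disp \<alpha> p1 k1 $ r" for r
    by (simp only: mult_eq_0_iff vector_minus_component right_minus_eq)
  moreover have "kron_disp \<alpha> p2 k2 $ r = kron_disp \<alpha> p1 k1 $ r" if "kron_disp \<alpha> q y $ r = 0" for r
    using sgn1[of r] sgn2[of r] unfolding that by (simp only: sgn_0 sgn_zero_iff)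
  ultimately show ?thesis unfolding vec_eq_iff by metis
qed

subsection \<open>Packing in an orthant\<close>

text \<open>Up to signs, \<open>V\<close> lies in the half-open cube of side \<open>s\<close>. Cut
  it into \<open>c ^ CARD('m)\<close> half-open cubes of side \<open>s / c\<close>: since
  \<open>sqrt (real CARD('m)) \<le> c\<close>, two points of one small cube are closer than
  \<open>s\<close>, so each holds at most one point of \<open>V\<close>. The map \<open>f\<close>
  records the small cube.\<close>

lemma card_separated_orthant_le_cubes:
  fixes V :: "(real ^ 'm) set" and c :: nat
  assumes c: "sqrt (real CARD('m)) \<le> real c"
    and sgn: "\<And>v r. v \<in> V \<Longrightarrow> sgn (v $ r) = \<tau> r"
    and small: "\<And>v. v \<in> V \<Longrightarrow> norm v < s"
    and sep: "\<And>v w. v \<in> V \<Longrightarrow> w \<in> V \<Longrightarrow> v \<noteq> w \<Longrightarrow> s \<le> norm (v - w)"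
  shows "card V \<le> c ^ CARD('m)"
proof (cases "V = {}")
  case False
  then have s: "s > 0" using small by (metis all_not_in_conv norm_ge_zero order_le_less_trans)
  have c0: "c > 0" using c zero_less_card_finite[where ?'a='m]
    by (metis gr0I of_nat_0 of_nat_0_less_iff real_sqrt_gt_zero not_less)
  define f where "f v = (\<lambda>r. nat \<lfloor>\<bar>v $ r\<bar> * real c / s\<rfloor>)" for v :: "real ^ 'm"
  have "f v \<in> UNIV \<rightarrow>\<^sub>E {..<c}" if "v \<in> V" for v
  proof -
    have "\<bar>v $ r\<bar> < s" for r using small[OF that] component_le_norm_cart[of v r] by linarith
    then have "\<bar>v $ r\<bar> * real c / s < real c" for r
      using s c0 by (simp only: pos_divide_less_eq mult.commute[of _ "real c"] mult_less_cancel_left_pos of_nat_0_less_iff)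
    then have "f v r < c" for r
      using s by (simp add: f_def nat_less_iff floor_less_iff)
    then show ?thesis by auto
  qed
  then have "f ` V \<subseteq> UNIV \<rightarrow>\<^sub>E {..<c}" by blast
  moreover have "inj_on f V"
  proof (rule inj_onI, rule ccontr)
    fix v w assume vw: "v \<in> V" "w \<in> V" "f v = f w" "v \<noteq> w"
    have close: "\<bar>v $ r - w $ r\<bar> < s / real c" for r
    proof -
      have pos: "0 < real c / s" using s c0 by simp
      let ?a = "\<bar>v $ r\<bar> * real c / s" and ?b = "\<bar>w $ r\<bar> * real c / s"
      have "nat \<lfloor>?a\<rfloor> = nat \<lfloor>?b\<rfloor>" using fun_cong[OF vw(3), of r] by (simp only: f_def)
      moreover have "0 \<le> ?a" "0 \<le> ?b" using s by auto
      ultimately have "\<lfloor>?a\<rfloor> = \<lfloor>?b\<rfloor>" by (simp only: eq_nat_nat_iff zero_le_floor)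
      then have "\<bar>?a - ?b\<bar> < 1" by linarith
      moreover have "?a - ?b = (\<bar>v $ r\<bar> - \<bar>w $ r\<bar>) * (real c / s)"
        by (simp add: diff_divide_distrib left_diff_distrib)
      ultimately have "\<bar>\<bar>v $ r\<bar> - \<bar>w $ r\<bar>\<bar> * (real c / s) < 1"
        by (simp only: abs_mult abs_of_pos[OF pos])
      then have "\<bar>\<bar>v $ r\<bar> - \<bar>w $ r\<bar>\<bar> * real c < s" using s by (simp only: times_divide_eq_right pos_divide_less_eq mult_1)
      then have "\<bar>\<bar>v $ r\<bar> - \<bar>w $ r\<bar>\<bar> < s / real c" using c0 by (simp only: pos_less_divide_eq of_nat_0_less_iff)
      then show ?thesis using abs_diff_same_sgn[of "v $ r" "w $ r"] by (simp only: sgn[OF vw(1)] sgn[OF vw(2)])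
    qed
    have "((v - w) $ r)\<^sup>2 < (s / real c)\<^sup>2" for r
      using power_strict_mono[OF close[of r] abs_ge_zero, of 2] by simp
    then have "(\<Sum>r\<in>UNIV. ((v - w) $ r)\<^sup>2) < (\<Sum>r\<in>(UNIV :: 'm set). (s / real c)\<^sup>2)"
      by (intro sum_strict_mono) auto
    also have "\<dots> = real CARD('m) * (s / real c)\<^sup>2" by simp
    also have "\<dots> \<le> (real c)\<^sup>2 * (s / real c)\<^sup>2"
      using sqrt_le_D[OF c] by (intro mult_right_mono) auto
    also have "\<dots> = s\<^sup>2" using c0 by (simp add: power_divide)
    finally have "(norm (v - w))\<^sup>2 < s\<^sup>2" by (simp add: norm_vec_def L2_set_def sum_nonneg)
    then have "norm (v - w) < s" by (rule power2_less_imp_less[OF _ less_imp_le[OF s]])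
    with sep[OF vw(1,2,4)] show False by simp
  qed
  ultimately have "card V \<le> card ((UNIV :: 'm set) \<rightarrow>\<^sub>E {..<c})"
    by (intro card_inj_on_le) (auto intro!: finite_PiE)
  then show ?thesis by (simp add: card_PiE)
qed simp

text \<open>Each squared norm is at most the largest coordinate times the coordinate sum, and the
  product of the two sums is at most \<open>4 * (x * y) + 3 * d\<close> with
  \<open>d = u * p + v * q\<close>. For nonzero vectors this is the squared form of a cosine of at
  least 1/2.\<close>

lemma three_coords_cos_ge_half:
  fixes x y u v p q :: real
  assumes "0 \<le> u" "u \<le> x" "0 \<le> v" "v \<le> x" "0 \<le> p" "p \<le> y" "0 \<le> q" "q \<le> y"
  shows "(x\<^sup>2 + u\<^sup>2 + v\<^sup>2) * (y\<^sup>2 + p\<^sup>2 + q\<^sup>2) \<le> 4 * (x * y + u * p + v * q)\<^sup>2"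
proof -
  define d where "d = u * p + v * q"
  have d: "0 \<le> d" using assms by (simp add: d_def)
  have xy: "0 \<le> x" "0 \<le> y" using assms(1,2,5,6) by (blast intro: order_trans)+
  have squares: "u\<^sup>2 \<le> x * u" "v\<^sup>2 \<le> x * v" "p\<^sup>2 \<le> y * p" "q\<^sup>2 \<le> y * q"
    unfolding power2_eq_square using assms by (simp_all only: mult_right_mono)
  have X: "x\<^sup>2 + u\<^sup>2 + v\<^sup>2 \<le> x * (x + u + v)"
    unfolding distrib_left power2_eq_square[of x] by (intro add_mono order_refl squares)
  have Y: "y\<^sup>2 + p\<^sup>2 + q\<^sup>2 \<le> y * (y + p + q)"
    unfolding distrib_left power2_eq_square[of y] by (intro add_mono order_refl squares)
  have "(x\<^sup>2 + u\<^sup>2 + v\<^sup>2) * (y\<^sup>2 + p\<^sup>2 + q\<^sup>2) \<le> (x * (x + u + v)) * (y * (y + p + q))"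
    using X Y by (rule mult_mono) (use assms xy in simp_all)
  also have "\<dots> = (x * y) * ((x + u + v) * (y + p + q))" by (simp add: mult_ac)
  also have "\<dots> \<le> (x * y) * (4 * (x * y) + 3 * d)"
  proof (intro mult_left_mono)
    \<comment> \<open>The difference of the two sides is a sum of three nonnegative terms; the third
      uses \<open>\<bar>u - v\<bar> \<le> x\<close> and
      \<open>\<bar>p - q\<bar> \<le> y\<close>.\<close>
    have "0 \<le> (x - u) * (y - p)" "0 \<le> (x - v) * (y - q)"
      by (intro mult_nonneg_nonneg; simp only: assms diff_ge_0_iff_ge)+
    moreover have "0 \<le> (u - v) * (p - q) + x * y"
    proof -
      have "\<bar>u - v\<bar> * \<bar>p - q\<bar> \<le> x * y" using assms by (intro mult_mono) auto
      then have "\<bar>(u - v) * (p - q)\<bar> \<le> x * y" by (simp only: abs_mult)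
      then show ?thesis unfolding abs_le_iff by simp
    qed
    moreover have "4 * (x * y) + 3 * d - (x + u + v) * (y + p + q)
        = (x - u) * (y - p) + (x - v) * (y - q) + ((u - v) * (p - q) + x * y)"
      by (simp add: d_def algebra_simps)
    ultimately have "0 \<le> 4 * (x * y) + 3 * d - (x + u + v) * (y + p + q)"
      by (simp only: add_nonneg_nonneg)
    then show "(x + u + v) * (y + p + q) \<le> 4 * (x * y) + 3 * d" by (simp only: diff_ge_0_iff_ge)
  qed (use xy in simp)
  also have "\<dots> \<le> 4 * (x * y + d)\<^sup>2"
    using xy d by (simp add: power2_eq_square algebra_simps)
  finally show ?thesis by (simp add: d_def add.assoc)
qed

text \<open>
  Two vectors of the same orthant with at most three nonzero coordinates, whose largest
  coordinate is in the same place, enclose an angle of at most 60 degrees.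
\<close>

lemma norm_diff_le_max_same_sector:
  fixes v w :: "real ^ 'm"
  assumes sgn: "\<And>r. sgn (v $ r) = sgn (w $ r)"
    and supp: "\<And>r. r \<notin> T \<Longrightarrow> v $ r = 0" "card T \<le> 3" "i \<in> T"
    and maxv: "\<And>r. \<bar>v $ r\<bar> \<le> \<bar>v $ i\<bar>" and maxw: "\<And>r. \<bar>w $ r\<bar> \<le> \<bar>w $ i\<bar>"
  shows "norm (v - w) \<le> max (norm v) (norm w)"
proof -
  have suppw: "w $ r = 0" if "r \<notin> T" for r by (metis supp(1) that sgn sgn_zero_iff)
  have prod: "v $ r * w $ r = \<bar>v $ r\<bar> * \<bar>w $ r\<bar>" for r
  proof (cases "v $ r = 0")
    case False
    from mult_pos_same_sgn[OF sgn this] show ?thesis by (simp only: abs_mult[symmetric] abs_of_pos)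
  qed simp
  define B where "B = T - {i}"
  have T: "T = insert i B" "i \<notin> B" using supp(3) by (auto simp: B_def)
  have sums: "v \<bullet> v = \<bar>v $ i\<bar>\<^sup>2 + (\<Sum>r\<in>B. \<bar>v $ r\<bar>\<^sup>2)"
    "w \<bullet> w = \<bar>w $ i\<bar>\<^sup>2 + (\<Sum>r\<in>B. \<bar>w $ r\<bar>\<^sup>2)"
    "v \<bullet> w = \<bar>v $ i\<bar> * \<bar>w $ i\<bar> + (\<Sum>r\<in>B. \<bar>v $ r\<bar> * \<bar>w $ r\<bar>)"
  proof -
    have *: "(\<Sum>r\<in>UNIV. f r) = f i + (\<Sum>r\<in>B. f r)" if "\<And>r. r \<notin> T \<Longrightarrow> f r = 0" for f :: "'m \<Rightarrow> real"
    proof -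
      have "(\<Sum>r\<in>UNIV. f r) = (\<Sum>r\<in>T. f r)" using that by (intro sum.mono_neutral_right) auto
      then show ?thesis using T by simp
    qed
    show "v \<bullet> v = \<bar>v $ i\<bar>\<^sup>2 + (\<Sum>r\<in>B. \<bar>v $ r\<bar>\<^sup>2)"
      using *[of "\<lambda>r. v $ r * v $ r"] supp(1) by (simp add: inner_vec_def power2_eq_square)
    show "w \<bullet> w = \<bar>w $ i\<bar>\<^sup>2 + (\<Sum>r\<in>B. \<bar>w $ r\<bar>\<^sup>2)"
      using *[of "\<lambda>r. w $ r * w $ r"] suppw by (simp add: inner_vec_def power2_eq_square)
    show "v \<bullet> w = \<bar>v $ i\<bar> * \<bar>w $ i\<bar> + (\<Sum>r\<in>B. \<bar>v $ r\<bar> * \<bar>w $ r\<bar>)"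
      using *[of "\<lambda>r. v $ r * w $ r"] supp(1) by (simp add: inner_vec_def flip: prod)
  qed
  have nonneg: "0 \<le> v \<bullet> w" unfolding sums by (intro add_nonneg_nonneg sum_nonneg) auto
  have "card B \<le> 2" using supp(2,3) by (simp add: B_def card_Diff_singleton)
  then consider "card B = 0" | "card B = 1" | "card B = 2" by linarith
  then have prod_le: "(v \<bullet> v) * (w \<bullet> w) \<le> 4 * (v \<bullet> w)\<^sup>2"
  proof cases
    case 1
    then have "B = {}" by simp
    then show ?thesis unfolding sums by (simp add: power_mult_distrib)
  next
    case 2
    then obtain j where B: "B = {j}" by (auto simp: card_1_singleton_iff)
    \<comment> \<open>Two coordinates are padded by a zero third one.\<close>
    have "(\<bar>v $ i\<bar>\<^sup>2 + \<bar>v $ j\<bar>\<^sup>2 + 0\<^sup>2) * (\<bar>w $ i\<bar>\<^sup>2 + \<bar>w $ j\<bar>\<^sup>2 + 0\<^sup>2)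
        \<le> 4 * (\<bar>v $ i\<bar> * \<bar>w $ i\<bar> + \<bar>v $ j\<bar> * \<bar>w $ j\<bar> + 0 * 0)\<^sup>2"
      by (rule three_coords_cos_ge_half) (rule abs_ge_zero maxv maxw order_refl)+
    moreover have "(\<Sum>r\<in>B. f r) = f j" for f :: "'m \<Rightarrow> real" using B by simp
    ultimately show ?thesis unfolding sums by (simp only: mult_zero_left zero_power2 add_0_right)
  next
    case 3
    then obtain j k where B: "B = {j, k}" "j \<noteq> k" by (auto simp: card_2_iff)
    have "(\<bar>v $ i\<bar>\<^sup>2 + \<bar>v $ j\<bar>\<^sup>2 + \<bar>v $ k\<bar>\<^sup>2) * (\<bar>w $ i\<bar>\<^sup>2 + \<bar>w $ j\<bar>\<^sup>2 + \<bar>w $ k\<bar>\<^sup>2)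
        \<le> 4 * (\<bar>v $ i\<bar> * \<bar>w $ i\<bar> + \<bar>v $ j\<bar> * \<bar>w $ j\<bar> + \<bar>v $ k\<bar> * \<bar>w $ k\<bar>)\<^sup>2"
      by (rule three_coords_cos_ge_half) (rule abs_ge_zero maxv maxw order_refl)+
    moreover have "(\<Sum>r\<in>B. f r) = f j + f k" for f :: "'m \<Rightarrow> real" using B by simp
    ultimately show ?thesis unfolding sums by (simp only: add.assoc)
  qed
  \<comment> \<open>If one squared norm is at most twice the inner product, expanding the square
    bounds the distance by the other norm.\<close>
  then have min: "v \<bullet> v \<le> 2 * (v \<bullet> w) \<or> w \<bullet> w \<le> 2 * (v \<bullet> w)"
  proof -
    have "\<not> (2 * (v \<bullet> w) < v \<bullet> v \<and> 2 * (v \<bullet> w) < w \<bullet> w)"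
    proof
      assume "2 * (v \<bullet> w) < v \<bullet> v \<and> 2 * (v \<bullet> w) < w \<bullet> w"
      then have "(2 * (v \<bullet> w)) * (2 * (v \<bullet> w)) < (v \<bullet> v) * (w \<bullet> w)"
        using nonneg by (intro mult_strict_mono) auto
      with prod_le show False by (simp add: power2_eq_square)
    qed
    then show ?thesis by linarith
  qed
  have "(v - w) \<bullet> (v - w) = v \<bullet> v + w \<bullet> w - 2 * (v \<bullet> w)"
    by (simp add: inner_diff_left inner_diff_right inner_commute)
  with min have "(v - w) \<bullet> (v - w) \<le> v \<bullet> v \<or> (v - w) \<bullet> (v - w) \<le> w \<bullet> w" by linarith
  then have "norm (v - w) \<le> norm v \<or> norm (v - w) \<le> norm w" by (simp add: norm_le)
  then show ?thesis by auto
qed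

text \<open>Send each vector to a place of its largest coordinate, ties broken by choice. Vectors
  with the same place are no farther apart than the larger norm, hence closer than \<open>s\<close>;
  so this map into the support is injective.\<close>

lemma card_separated_orthant_le_support:
  fixes V :: "(real ^ 'm) set" and \<tau> :: "'m \<Rightarrow> real"
  assumes supp: "card {r. \<tau> r \<noteq> 0} \<le> 3" "{r. \<tau> r \<noteq> 0} \<noteq> {}"
    and sgn: "\<And>v r. v \<in> V \<Longrightarrow> sgn (v $ r) = \<tau> r"
    and small: "\<And>v. v \<in> V \<Longrightarrow> norm v < s"
    and sep: "\<And>v w. v \<in> V \<Longrightarrow> w \<in> V \<Longrightarrow> v \<noteq> w \<Longrightarrow> s \<le> norm (v - w)"
  shows "card V \<le> card {r. \<tau> r \<noteq> 0}"
proof -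
  let ?T = "{r. \<tau> r \<noteq> 0}"
  define f where "f v = (SOME i. i \<in> ?T \<and> (\<forall>r. \<bar>v $ r\<bar> \<le> \<bar>v $ i\<bar>))" for v :: "real ^ 'm"
  have supp0: "v $ r = 0" if "v \<in> V" "r \<notin> ?T" for v r
    using sgn[OF that(1), of r] that(2) by (simp add: sgn_zero_iff)
  have f: "f v \<in> ?T \<and> (\<forall>r. \<bar>v $ r\<bar> \<le> \<bar>v $ f v\<bar>)" if v: "v \<in> V" for v
  proof -
    have "Max ((\<lambda>r. \<bar>v $ r\<bar>) ` ?T) \<in> (\<lambda>r. \<bar>v $ r\<bar>) ` ?T" using supp(2) by (intro Max_in) auto
    then obtain i where i: "Max ((\<lambda>r. \<bar>v $ r\<bar>) ` ?T) = \<bar>v $ i\<bar>" "i \<in> ?T" by (rule imageE)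
    have "\<bar>v $ r\<bar> \<le> \<bar>v $ i\<bar>" for r
    proof (cases "r \<in> ?T")
      case True
      then have "\<bar>v $ r\<bar> \<le> Max ((\<lambda>r. \<bar>v $ r\<bar>) ` ?T)" by (intro Max_ge) auto
      then show ?thesis by (simp only: i(1))
    qed (use supp0[OF v] in simp)
    with i(2) have "\<exists>i. i \<in> ?T \<and> (\<forall>r. \<bar>v $ r\<bar> \<le> \<bar>v $ i\<bar>)" by blast
    then show ?thesis unfolding f_def by (rule someI_ex)
  qed
  have "inj_on f V"
  proof (rule inj_onI, rule ccontr)
    fix v w assume vw: "v \<in> V" "w \<in> V" "f v = f w" "v \<noteq> w"
    have "norm (v - w) \<le> max (norm v) (norm w)"
    proof (rule norm_diff_le_max_same_sector[OF _ supp0[OF vw(1)] supp(1)])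
      show "sgn (v $ r) = sgn (w $ r)" for r by (simp only: sgn[OF vw(1)] sgn[OF vw(2)])
      show "f v \<in> ?T" "\<bar>v $ r\<bar> \<le> \<bar>v $ f v\<bar>" for r using f[OF vw(1)] by simp_all
      show "\<bar>w $ r\<bar> \<le> \<bar>w $ f v\<bar>" for r using f[OF vw(2)] unfolding vw(3) by simp
    qed
    with small[OF vw(1)] small[OF vw(2)] sep[OF vw(1,2,4)] show False by linarith
  qed
  then show ?thesis using f by (intro card_inj_on_le[of f]) auto
qed

subsection \<open>Counting the gap lengths\<close>

text \<open>The largest length \<open>a\<close> of the class is set aside, which accounts for the
  \<open>+ 1\<close>. Against its pair, \<open>is_gap_same_signs_eq\<close> makes the other
  displacements, all shorter than \<open>a\<close>, pairwise at least \<open>a\<close> apart, so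
  \<open>pack\<close> applies to them with \<open>s = a\<close>.\<close>

lemma card_same_signs_le:
  fixes \<alpha> :: "real ^ 'm" and w :: "real \<Rightarrow> int \<times> int"
  defines "\<Delta> \<equiv> \<lambda>d. kron_disp \<alpha> (fst (w d)) (snd (w d))"
  assumes fin: "finite A"
    and gap: "\<And>d. d \<in> A \<Longrightarrow> is_gap \<alpha> n (fst (w d)) (snd (w d))"
    and dist: "\<And>d. d \<in> A \<Longrightarrow> norm (\<Delta> d) = d"
    and sgn: "\<And>d r. d \<in> A \<Longrightarrow> sgn (\<Delta> d $ r) = \<tau> r"
    and pack: "\<And>s V. (\<And>v r. v \<in> V \<Longrightarrow> sgn (v $ r) = \<tau> r) \<Longrightarrow> (\<And>v. v \<in> V \<Longrightarrow> norm v < s) \<Longrightarrow>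
       (\<And>v v'. v \<in> V \<Longrightarrow> v' \<in> V \<Longrightarrow> v \<noteq> v' \<Longrightarrow> s \<le> norm (v - v')) \<Longrightarrow> card V \<le> N"
  shows "card A \<le> N + 1"
proof (cases "A = {}")
  case False
  define a where "a = Max A"
  have a: "a \<in> A" and le: "\<And>d. d \<in> A \<Longrightarrow> d \<le> a" using fin False by (auto simp: a_def)
  let ?B = "A - {a}"
  have less: "norm (\<Delta> d) < norm (\<Delta> a)" if "d \<in> ?B" for d using that le[of d] a by (simp add: dist less_le)
  have range: "1 \<le> fst (w d)" "fst (w d) < snd (w d)" "snd (w d) \<le> int n" if "d \<in> A" for d
    using gap[OF that] unfolding is_gap_def by simp_all
  have disp: "\<Delta> d = kron_disp \<alpha> (fst (w d)) (snd (w d))" for d by (simp only: \<Delta>_def)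
  have inj: "inj_on \<Delta> ?B" by (rule inj_on_inverseI[where g = norm]) (simp add: dist)
  have sep: "a \<le> norm (\<Delta> d - \<Delta> e)"
    if de: "d \<in> ?B" "e \<in> ?B" "\<Delta> d \<noteq> \<Delta> e" and lt: "snd (w e) - fst (w e) < snd (w d) - fst (w d)" for d e
  proof (rule ccontr)
    assume "\<not> ?thesis"
    then have close: "norm (\<Delta> d - \<Delta> e) < norm (\<Delta> a)" using dist a by simp
    from de have A: "e \<in> A" "d \<in> A" by simp_all
    have "\<Delta> e = \<Delta> d" unfolding \<Delta>_def
      by (rule is_gap_same_signs_eq[OF gap[OF a] range[OF A(1)] range[OF A(2)] _ _ _ _ _ lt])
        (fold disp, simp_all only: sgn[OF a] sgn[OF A(1)] sgn[OF A(2)] less[OF de(1)] less[OF de(2)] close)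
    with de show False by simp
  qed
  have "card (\<Delta> ` ?B) \<le> N"
  proof (rule pack[where s = a])
    fix v v' assume "v \<in> \<Delta> ` ?B" "v' \<in> \<Delta> ` ?B" "v \<noteq> v'"
    then obtain d e where de: "d \<in> ?B" "e \<in> ?B" "v = \<Delta> d" "v' = \<Delta> e" "\<Delta> d \<noteq> \<Delta> e" by blast
    \<comment> \<open>Equal index differences would give equal norms, and the norm of a chosen
      displacement is its gap length.\<close>
    have "snd (w d) - fst (w d) \<noteq> snd (w e) - fst (w e)"
    proof
      assume "snd (w d) - fst (w d) = snd (w e) - fst (w e)"
      then have "norm (\<Delta> d) = norm (\<Delta> e)" unfolding \<Delta>_def by (rule norm_kron_disp_cong)
      then have "d = e" using dist de(1,2) by simp
      with de show False by simp
    qed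
    then consider "snd (w e) - fst (w e) < snd (w d) - fst (w d)"
      | "snd (w d) - fst (w d) < snd (w e) - fst (w e)" by (metis linorder_neqE)
    then show "a \<le> norm (v - v')"
    proof cases
      case 1
      show ?thesis unfolding de(3,4) by (rule sep[OF de(1,2,5) 1])
    next
      case 2
      show ?thesis unfolding de(3,4)
        by (subst norm_minus_commute) (rule sep[OF de(2,1) de(5)[symmetric] 2])
    qed
  next
    show "sgn (v $ r) = \<tau> r" if "v \<in> \<Delta> ` ?B" for v r using that sgn by auto
    show "norm v < a" if "v \<in> \<Delta> ` ?B" for v using that less dist[OF a] by auto
  qed
  then have "card ?B \<le> N" by (simp add: card_image[OF inj])
  then show ?thesis using a fin by simp
qed simp

text \<open>Choose one pair for each gap length and sort the lengths by the signs of its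
  displacement. The zero pattern can only carry the length 0, whence the leading 1; every other
  class is bounded by \<open>card_same_signs_le\<close>.\<close>

lemma card_gap_lengths_le_sum:
  fixes \<alpha> :: "real ^ 'm" and N :: "('m \<Rightarrow> real) \<Rightarrow> nat"
  assumes pack: "\<And>\<tau> s V. {r. \<tau> r \<noteq> 0} \<noteq> {} \<Longrightarrow>
      (\<And>v r. v \<in> V \<Longrightarrow> sgn (v $ r) = \<tau> r) \<Longrightarrow> (\<And>v. v \<in> V \<Longrightarrow> norm v < s) \<Longrightarrow>
      (\<And>v w. v \<in> V \<Longrightarrow> w \<in> V \<Longrightarrow> v \<noteq> w \<Longrightarrow> s \<le> norm (v - w)) \<Longrightarrow> card (V :: (real ^ 'm) set) \<le> N \<tau>"
  shows "card (gap_lengths \<alpha> n) \<le> 1 + (\<Sum>\<tau>\<in>(UNIV \<rightarrow>\<^sub>E {-1, 0, 1}) - {\<lambda>_. 0}. N \<tau> + 1)"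
\<comment> \<open>\<open>card\<close> of an infinite set is 0, which settles the other case.\<close>
proof (cases "finite (gap_lengths \<alpha> n)")
  case fin: True
  let ?S = "gap_lengths \<alpha> n" and ?P = "(UNIV :: 'm set) \<rightarrow>\<^sub>E {-1, 0, 1 :: real}"
  have "\<forall>d\<in>?S. \<exists>x. is_gap \<alpha> n (fst x) (snd x) \<and> kron_dist \<alpha> (fst x) (snd x) = d"
    by (force simp: gap_lengths_def is_gap_def)
  then obtain w where w: "\<And>d. d \<in> ?S \<Longrightarrow> is_gap \<alpha> n (fst (w d)) (snd (w d))"
    "\<And>d. d \<in> ?S \<Longrightarrow> kron_dist \<alpha> (fst (w d)) (snd (w d)) = d"
    by metis
  define \<Delta> where "\<Delta> = (\<lambda>d. kron_disp \<alpha> (fst (w d)) (snd (w d)))"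
  define \<sigma> where "\<sigma> d = (\<lambda>r. sgn (\<Delta> d $ r))" for d
  define A where "A \<tau> = {d \<in> ?S. \<sigma> d = \<tau>}" for \<tau>
  have dist: "norm (\<Delta> d) = d" if "d \<in> ?S" for d using w(2)[OF that] by (simp add: \<Delta>_def kron_dist_eq_norm)
  have finP: "finite ?P" by (intro finite_PiE) auto
  have "\<sigma> d \<in> ?P" for d by (simp add: \<sigma>_def PiE_iff sgn_real_def)
  then have "?S \<subseteq> (\<Union>\<tau>\<in>?P. A \<tau>)" by (auto simp: A_def)
  then have "card ?S \<le> card (\<Union>\<tau>\<in>?P. A \<tau>)"
    using finP fin by (intro card_mono) (auto simp: A_def)
  also have "\<dots> \<le> (\<Sum>\<tau>\<in>?P. card (A \<tau>))" by (rule card_UN_le[OF finP])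
  also have "\<dots> = card (A (\<lambda>_. 0)) + (\<Sum>\<tau>\<in>?P - {\<lambda>_. 0}. card (A \<tau>))"
    using finP by (intro sum.remove) auto
  also have "\<dots> \<le> 1 + (\<Sum>\<tau>\<in>?P - {\<lambda>_. 0}. N \<tau> + 1)"
  proof (intro add_mono sum_mono)
    have "A (\<lambda>_. 0) \<subseteq> {0}"
    proof
      fix d assume "d \<in> A (\<lambda>_. 0)"
      then have d: "d \<in> ?S" "\<Delta> d = 0" by (auto simp: A_def \<sigma>_def fun_eq_iff vec_eq_iff sgn_zero_iff)
      then show "d \<in> {0}" using dist[OF d(1)] by simp
    qed
    then show "card (A (\<lambda>_. 0)) \<le> 1" using card_mono[of "{0 :: real}" "A (\<lambda>_. 0)"] by simp
    fix \<tau> assume "\<tau> \<in> ?P - {\<lambda>_. 0}"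
    then have nonzero: "{r. \<tau> r \<noteq> 0} \<noteq> {}" by (auto simp: fun_eq_iff)
    show "card (A \<tau>) \<le> N \<tau> + 1"
    proof (rule card_same_signs_le[where w = w and \<alpha> = \<alpha> and \<tau> = \<tau> and n = n])
      show "finite (A \<tau>)" using fin by (simp add: A_def)
      fix d assume "d \<in> A \<tau>"
      then have d: "d \<in> ?S" "\<sigma> d = \<tau>" by (simp_all add: A_def)
      show "is_gap \<alpha> n (fst (w d)) (snd (w d))" by (rule w(1)[OF d(1)])
      show "norm (kron_disp \<alpha> (fst (w d)) (snd (w d))) = d" using dist[OF d(1)] by (simp only: \<Delta>_def)
      show "sgn (kron_disp \<alpha> (fst (w d)) (snd (w d)) $ r) = \<tau> r" for r
        using fun_cong[OF d(2), of r] by (simp only: \<sigma>_def \<Delta>_def)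
    qed (rule pack[OF nonzero])
  qed
  finally show ?thesis .
qed simp

text \<open>The angular bound is taken for small supports because the cube bound alone, with
  \<open>c = 2\<close>, would exceed the final estimate in dimensions 2, 3 and 4.\<close>

lemma card_gap_lengths_le_sum_packing:
  fixes \<alpha> :: "real ^ 'm" and c :: nat
  assumes c: "sqrt (real CARD('m)) \<le> real c"
  shows "card (gap_lengths \<alpha> n) \<le> 1 + (\<Sum>\<tau>\<in>((UNIV :: 'm set) \<rightarrow>\<^sub>E {-1, 0, 1 :: real}) - {\<lambda>_. 0}.
    (if card {r. \<tau> r \<noteq> 0} \<le> 3 then card {r. \<tau> r \<noteq> 0} else c ^ CARD('m)) + 1)"
proof (rule card_gap_lengths_le_sum)
  fix \<tau> :: "'m \<Rightarrow> real" and s and V :: "(real ^ 'm) set"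
  assume nonzero: "{r. \<tau> r \<noteq> 0} \<noteq> {}"
    and V: "\<And>v r. v \<in> V \<Longrightarrow> sgn (v $ r) = \<tau> r" "\<And>v. v \<in> V \<Longrightarrow> norm v < s"
      "\<And>v w. v \<in> V \<Longrightarrow> w \<in> V \<Longrightarrow> v \<noteq> w \<Longrightarrow> s \<le> norm (v - w)"
  show "card V \<le> (if card {r. \<tau> r \<noteq> 0} \<le> 3 then card {r. \<tau> r \<noteq> 0} else c ^ CARD('m))"
  proof (cases "card {r. \<tau> r \<noteq> 0} \<le> 3")
    case True
    have "card V \<le> card {r. \<tau> r \<noteq> 0}"
      by (rule card_separated_orthant_le_support[where V = V, OF True nonzero]; fact V)
    with True show ?thesis by (simp only: if_True)
  next
    case False
    have "card V \<le> c ^ CARD('m)" by (rule card_separated_orthant_le_cubes[where V = V, OF c]; fact V)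
    with False show ?thesis by (simp only: if_False)
  qed
qed

section \<open>Numbers of sign patterns and the closing estimates\<close>

lemma card_sign_patterns:
  "card (((UNIV :: 'm::finite set) \<rightarrow>\<^sub>E {-1, 0, 1 :: real}) - {\<lambda>_. 0}) = 3 ^ CARD('m) - 1"
  by (subst card_Diff_singleton) (auto simp: card_PiE card_insert_if numeral_3_eq_3)

lemma card_full_sign_patterns:
  "card ((UNIV :: 'm::finite set) \<rightarrow>\<^sub>E {-1, 1 :: real}) = 2 ^ CARD('m)"
  by (simp add: card_PiE card_insert_if numeral_2_eq_2)

theorem theorem2:
  fixes \<alpha> :: "real ^ 'm" and n :: nat
  assumes "n > 0"
  shows "int (card (gap_lengths \<alpha> n)) \<le>
    \<lceil>sqrt (real CARD('m))\<rceil> ^ CARD('m) *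
      (\<lceil>sqrt (real CARD('m))\<rceil> ^ CARD('m) + 2 ^ CARD('m) + 1) + 2"
proof -
  let ?m = "CARD('m)" and ?P = "((UNIV :: 'm set) \<rightarrow>\<^sub>E {-1, 0, 1 :: real}) - {\<lambda>_. 0}"
  define c where "c = nat \<lceil>sqrt (real ?m)\<rceil>"
  have "0 \<le> \<lceil>sqrt (real ?m)\<rceil>"
    using ceiling_mono[of 0 "sqrt (real ?m)"] by simp
  then have ceil: "\<lceil>sqrt (real ?m)\<rceil> = int c" by (simp add: c_def)
  have c: "sqrt (real ?m) \<le> real c" by (simp add: c_def real_nat_ceiling_ge)
  \<comment> \<open>Used with \<open>k = 1\<close> in dimensions 2 and 3, and with
    \<open>k = 2\<close> from dimension 5 on.\<close>
  have c_gt: "k < c" if "k * k < ?m" for k :: nat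
  proof -
    have "real k * real k < real ?m" using that by (metis of_nat_less_iff of_nat_mult)
    then have "real k < sqrt (real ?m)" by (intro real_less_rsqrt) (simp add: power2_eq_square)
    with c show ?thesis by linarith
  qed
  have m0: "?m > 0" by simp
  have finP: "finite ?P" by (intro finite_Diff finite_PiE) auto
  let ?N = "\<lambda>\<tau> :: 'm \<Rightarrow> real. if card {r. \<tau> r \<noteq> 0} \<le> 3 then card {r. \<tau> r \<noteq> 0} else c ^ ?m"
  note bound = card_gap_lengths_le_sum_packing[OF c, of \<alpha> n]
  have supp_le: "card {r. \<tau> r \<noteq> 0} \<le> ?m" for \<tau> :: "'m \<Rightarrow> real" by (rule card_mono) auto
  have "card (gap_lengths \<alpha> n) \<le> c ^ ?m * (c ^ ?m + 2 ^ ?m + 1) + 2"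
  proof -
    consider "?m \<le> 3" | "?m = 4" | "?m \<ge> 5" by linarith
    then show ?thesis
    proof cases
      case 1
      \<comment> \<open>Every support has at most three places, so the angular bound covers all
        patterns. The totals are 5, 25 and 105, against 6, 38 and 138.\<close>
      have "(\<Sum>\<tau>\<in>?P. ?N \<tau> + 1) \<le> (\<Sum>\<tau>\<in>?P. ?m + 1)"
        using 1 supp_le by (intro sum_mono) (auto intro: order_trans)
      also have "\<dots> = (3 ^ ?m - 1) * (?m + 1)" by (simp add: card_sign_patterns)
      finally have le: "card (gap_lengths \<alpha> n) \<le> 1 + (3 ^ ?m - 1) * (?m + 1)" using bound by linarith
      from 1 m0 consider "?m = 1" | "?m = 2" | "?m = 3" by linarith
      then show ?thesis
      proof cases
        case 1
        then have "c = 1" using c by (simp add: c_def)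
        with le 1 show ?thesis by simp
      next
        case 2
        then have "2 ^ 2 \<le> c ^ 2" using c_gt[of 1] by (intro power_mono) auto
        then have "c ^ ?m \<ge> 4" using 2 by simp
        then have "c ^ ?m * (c ^ ?m + 2 ^ ?m + 1) \<ge> 4 * (4 + 2 ^ ?m + 1)" by (intro mult_mono) auto
        with le 2 show ?thesis by simp
      next
        case 3
        then have "2 ^ 3 \<le> c ^ 3" using c_gt[of 1] by (intro power_mono) auto
        then have "c ^ ?m \<ge> 8" using 3 by simp
        then have "c ^ ?m * (c ^ ?m + 2 ^ ?m + 1) \<ge> 8 * (8 + 2 ^ ?m + 1)" by (intro mult_mono) auto
        with le 3 show ?thesis by simp
      qed
    next
      case 2
      \<comment> \<open>Only the 16 patterns without a zero need the cube bound
        \<open>2 ^ 4\<close>; the other 64 have support at most 3. The sum is 64 * 4 + 16 * 17 =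
        528.\<close>
      let ?F = "(UNIV :: 'm set) \<rightarrow>\<^sub>E {-1, 1 :: real}"
      have "sqrt 4 = (2 :: real)" using real_sqrt_abs[of 2] by simp
      then have c2: "c = 2" using 2 by (simp add: c_def)
      have FP: "?F \<subseteq> ?P" by (auto simp: PiE_iff fun_eq_iff)
      have cardF: "card ?F = 16" using card_full_sign_patterns[where ?'m = 'm] 2 by simp
      have cardP: "card ?P = 80" using card_sign_patterns[where ?'m = 'm] 2 by simp
      have finF: "finite ?F" by (intro finite_PiE) auto
      have N_full: "?N \<tau> \<le> 16" for \<tau> using 2 c2 by simp
      have N_part: "?N \<tau> \<le> 3" if "\<tau> \<in> ?P - ?F" for \<tau>
      proof -
        have "\<not> (\<forall>r. \<tau> r \<in> {-1, 1})" using that by (auto simp: PiE_iff)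
        then obtain r where "\<tau> r \<notin> {-1, 1}" by blast
        moreover have "\<tau> r \<in> {-1, 0, 1}" using that by (simp add: PiE_iff)
        ultimately have "\<tau> r = 0" by blast
        then have "{r. \<tau> r \<noteq> 0} \<subset> UNIV" by auto
        then have "card {r. \<tau> r \<noteq> 0} < ?m" by (intro psubset_card_mono) auto
        with 2 show ?thesis by simp
      qed
      have "(\<Sum>\<tau>\<in>?P. ?N \<tau> + 1) = (\<Sum>\<tau>\<in>?P - ?F. ?N \<tau> + 1) + (\<Sum>\<tau>\<in>?F. ?N \<tau> + 1)"
        by (rule sum.subset_diff[OF FP finP])
      also have "\<dots> \<le> (\<Sum>\<tau>\<in>?P - ?F. 4) + (\<Sum>\<tau>\<in>?F. 17)"
      proof (intro add_mono sum_mono)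
        show "?N \<tau> + 1 \<le> 4" if "\<tau> \<in> ?P - ?F" for \<tau> using N_part[OF that] by linarith
        show "?N \<tau> + 1 \<le> 17" for \<tau> using N_full[of \<tau>] by linarith
      qed
      also have "\<dots> = 528" using card_Diff_subset[OF finF FP] cardF cardP by simp
      finally show ?thesis using bound 2 c2 by simp
    next
      case 3
      \<comment> \<open>From here on \<open>c \<ge> 3\<close>, so the number of patterns is below
        \<open>c ^ ?m\<close> and the cube bound can replace the angular one throughout.\<close>
      have c3: "3 \<le> c" using c_gt[of 2] 3 by simp
      have "1 ^ ?m \<le> c ^ ?m" "3 ^ ?m \<le> c ^ ?m" using c3 by (auto intro!: power_mono simp del: power_one)
      moreover have "3 \<le> c ^ ?m" using c3 self_le_power[of c ?m] m0 by linarith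
      ultimately have N: "?N \<tau> \<le> c ^ ?m" for \<tau> by auto
      have "(\<Sum>\<tau>\<in>?P. ?N \<tau> + 1) \<le> (\<Sum>\<tau>\<in>?P. c ^ ?m + 1)" by (intro sum_mono add_right_mono N)
      also have "\<dots> = (3 ^ ?m - 1) * (c ^ ?m + 1)" by (simp add: card_sign_patterns)
      also have "\<dots> \<le> c ^ ?m * (c ^ ?m + 1)" using \<open>3 ^ ?m \<le> c ^ ?m\<close> by (intro mult_right_mono order_trans[OF diff_le_self]) auto
      also have "\<dots> \<le> c ^ ?m * (c ^ ?m + 2 ^ ?m + 1)" by simp
      finally show ?thesis using bound by linarith
    qed
  qed
  then have "int (card (gap_lengths \<alpha> n)) \<le> int (c ^ ?m * (c ^ ?m + 2 ^ ?m + 1) + 2)"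
    by (simp only: of_nat_le_iff)
  then show ?thesis unfolding ceil by (simp add: algebra_simps)
qed

end
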